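(* Let $\mathcal{M} \subset \Delta_{n-1}$ be any statistical model (any subset of the open probability simplex). Then for every $p \in \mathcal{M}$ the logarithmic Voronoi cell $\log \mathrm{Vor}_{\mathcal{M}}(p)$ is a convex set.
   Context: $\Delta_{n-1} = \{u \in \mathbb{R}^n : \sum_{i=1}^n u_i = 1,\ u_i > 0 \text{ for all } i\}$ is the open probability simplex. For $u \in \Delta_{n-1}$ let $\ell_u(q) = \sum_{i=1}^n u_i \log(q_i)$. Write $\Phi(u)=p$ if $p \in \mathcal{M}$ and $p \in \operatorname{argmax}_{q \in \mathcal{M}} \ell_u(q)$ (ties allowed). The logarithmic Voronoi cell of $p \in \mathcal{M}$ is $\log \mathrm{Vor}_{\mathcal{M}}(p) = \{u \in \Delta_{n-1} : \Phi(u) = p\}$. *)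

theory Defs
  imports "HOL-Analysis.Analysis"
begin

definition open_simplex :: "(real ^ 'n) set" where
  "open_simplex = {u. (\<Sum>i\<in>UNIV. u $ i) = 1 \<and> (\<forall>i. u $ i > 0)}"

definition log_likelihood :: "real ^ 'n \<Rightarrow> real ^ 'n \<Rightarrow> real" where
  "log_likelihood u q = (\<Sum>i\<in>UNIV. u $ i * ln (q $ i))"

text \<open>The relation written \<open>\<Phi>(u) = p\<close>. It is a relation rather than a function since
  \<open>u\<close> may have several maximum likelihood estimates in \<open>M\<close>, or none.\<close>

definition is_mle :: "(real ^ 'n) set \<Rightarrow> real ^ 'n \<Rightarrow> real ^ 'n \<Rightarrow> bool" where
  "is_mle M u p \<longleftrightarrow> is_arg_max (log_likelihood u) (\<lambda>q. q \<in> M) p"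

definition log_Voronoi :: "(real ^ 'n) set \<Rightarrow> real ^ 'n \<Rightarrow> (real ^ 'n) set" where
  "log_Voronoi M p = {u \<in> open_simplex. is_mle M u p}"

end

theory Submission
  imports Defs
begin

text \<open>
  For a fixed point \<open>q\<close>, the log-likelihood \<open>\<ell>\<^sub>u(q)\<close> is linear in the data \<open>u\<close>: it is the inner
  product of \<open>u\<close> with the vector of logarithms of \<open>q\<close>. A competitor \<open>q \<in> M\<close> therefore fails to
  beat \<open>p\<close> exactly for the \<open>u\<close> in a closed half-space through the origin. The logarithmic Voronoi
  cell of \<open>p\<close> is the intersection of the simplex with these half-spaces, one for each \<open>q \<in> M\<close>, and
  any intersection of convex sets is convex, whatever the shape of \<open>M\<close>.
\<close>

lemma log_likelihood_eq_inner: "log_likelihood u q = (\<chi> i. ln (q $ i)) \<bullet> u"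
  by (simp add: log_likelihood_def inner_vec_def mult.commute)

lemma convex_open_simplex: "convex (open_simplex :: (real ^ 'n) set)"
proof -
  have "(open_simplex :: (real ^ 'n) set) =
      {u. (\<chi> i. 1) \<bullet> u = 1} \<inter> (\<Inter>i. {u. axis i 1 \<bullet> u > 0})"
    unfolding inner_axis'
    by (auto simp: open_simplex_def inner_vec_def)
  moreover have "convex \<dots>"
    by (intro convex_Int convex_INT convex_hyperplane convex_halfspace_gt)
  ultimately show ?thesis
    by (rule ssubst)
qed

lemma log_Voronoi_eq_halfspaces:
  fixes M :: "(real ^ 'n) set"
  assumes "p \<in> M"
  shows "log_Voronoi M p =
    open_simplex \<inter> (\<Inter>q\<in>M. {u. ((\<chi> i. ln (q $ i)) - (\<chi> i. ln (p $ i))) \<bullet> u \<le> 0})"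
  using assms
  by (auto simp: log_Voronoi_def is_mle_def is_arg_max_linorder log_likelihood_eq_inner
      inner_diff_left)

theorem proposition4:
  fixes M :: "(real ^ 'n) set" and p :: "real ^ 'n"
  assumes "M \<subseteq> open_simplex" and "p \<in> M"
  shows "convex (log_Voronoi M p)"
  unfolding log_Voronoi_eq_halfspaces[OF assms(2)]
  by (intro convex_Int convex_INT convex_open_simplex convex_halfspace_le)

end
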